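(* Let $r\in(\mathbb{N}\setminus\{1\})\cup\{\infty\}$. A finite simple graph $G$ has radius-$r$ flip-width at most $2$ if and only if $G$ contains no induced subgraph isomorphic to $C_5$, the bull, the gem, or the co-gem.
   Context: $\mathbb{N}$ is the set of positive integers. All graphs are finite, undirected, simple. Flips: for a graph $G$ and $A,B\subseteq V(G)$, $G\oplus(A,B)$ is the graph on $V(G)$ in which, for distinct $u,v$, $uv$ is an edge iff either $(u,v)\in(A\times B)\cup(B\times A)$ and $uv\notin E(G)$, or $(u,v)\notin(A\times B)\cup(B\times A)$ and $uv\in E(G)$. For a collection $\mathcal{S}$ of such pairs, $G\oplus\mathcal{S}$ is obtained by flipping all pairs in $\mathcal{S}$ successively (order is irrelevant). For a partition $\mathcal{P}$ of $V(G)$, a $\mathcal{P}$-flip of $G$ is any graph $G\oplus\mathcal{S}$ where every pair in $\mathcal{S}$ is $(X,Y)$ with $X,Y\in\mathcal{P}$ (possibly $X=Y$); it is a $k$-flip if $|\mathcal{P}|\le k$. Flipper game of radius $r\in\mathbb{N}\cup\{\infty\}$ and width $k$ on $G$: set $G_0=G$; the runner picks a starting vertex $v_0$. In round $i\ge1$ the flipper announces a $k$-flip $G_i$ of $G$; knowing $G_i$, the runner picks $v_i\in V(G)$ reachable from $v_{i-1}$ by a path of length at most $r$ in $G_{i-1}$ (for $r=\infty$: any vertex in the same component of $G_{i-1}$). The flipper wins as soon as the runner's position $v_i$ is an isolated vertex of $G_i$. The radius-$r$ flip-width $\mathrm{fw}_r(G)$ is the minimum $k$ such that the flipper has a winning strategy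 (winning after finitely many rounds) in this game. $C_5$ is the 5-cycle; with $abcd$ an induced path on four vertices and a fifth vertex $v$: the bull has $v$ adjacent exactly to $b,c$; the gem has $v$ adjacent to $a,b,c,d$; the co-gem has $v$ adjacent to none of them. *)

theory Defs
  imports
    "Graph_Theory.Graph_Theory"
    "HOL-Library.Extended_Nat"
    "HOL-Library.Disjoint_Sets"
begin

text \<open>
  Finite simple undirected graphs are the \<^locale>\<open>pair_graph\<close>s of the graph theory library: finite
  loop-free digraphs with a symmetric arc relation.  The edge $uv$ is represented by the two
  arcs $(u,v)$ and $(v,u)$.
\<close>

section \<open>Flips\<close>

definition flip :: "'a pair_pre_digraph \<Rightarrow> 'a set \<Rightarrow> 'a set \<Rightarrow> 'a pair_pre_digraph" where
  "flip G A B =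
     \<lparr> pverts = pverts G,
       parcs = {(u, v). u \<in> pverts G \<and> v \<in> pverts G \<and> u \<noteq> v \<and>
         ((u, v) \<in> A \<times> B \<union> B \<times> A \<and> (u, v) \<notin> parcs G \<or>
          (u, v) \<notin> A \<times> B \<union> B \<times> A \<and> (u, v) \<in> parcs G)} \<rparr>"

definition flips :: "'a pair_pre_digraph \<Rightarrow> ('a set \<times> 'a set) list \<Rightarrow> 'a pair_pre_digraph" where
  "flips G S = foldl (\<lambda>H (A, B). flip H A B) G S"

definition partition_flip ::
    "'a set set \<Rightarrow> 'a pair_pre_digraph \<Rightarrow> 'a pair_pre_digraph \<Rightarrow> bool" where
  "partition_flip P G H \<longleftrightarrow> (\<exists>S. set S \<subseteq> P \<times> P \<and> H = flips G S)"

definition k_flip :: "nat \<Rightarrow> 'a pair_pre_digraph \<Rightarrow> 'a pair_pre_digraph \<Rightarrow> bool" where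
  "k_flip k G H \<longleftrightarrow> (\<exists>P. partition_on (pverts G) P \<and> card P \<le> k \<and> partition_flip P G H)"


section \<open>The flipper game\<close>

definition reach_within :: "enat \<Rightarrow> 'a pair_pre_digraph \<Rightarrow> 'a \<Rightarrow> 'a \<Rightarrow> bool" where
  "reach_within r H u v \<longleftrightarrow>
     (\<exists>p. pre_digraph.apath (with_proj H) u p v \<and> enat (length p) \<le> r)"

definition isolated :: "'a pair_pre_digraph \<Rightarrow> 'a \<Rightarrow> bool" where
  "isolated H v \<longleftrightarrow> v \<in> pverts H \<and> (\<forall>w. (v, w) \<notin> parcs H)"

text \<open>
  A strategy of the flipper maps the positions $v_0, \ldots, v_{i-1}$ visited so far to the graph
  $G_i$ announced in round $i \ge 1$.  The graphs announced earlier are determined by the strategy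
  and these positions, so this is the full history of the game.
\<close>

type_synonym 'a flip_strategy = "'a list \<Rightarrow> 'a pair_pre_digraph"

definition announced ::
    "'a pair_pre_digraph \<Rightarrow> 'a flip_strategy \<Rightarrow> (nat \<Rightarrow> 'a) \<Rightarrow> nat \<Rightarrow> 'a pair_pre_digraph" where
  "announced G \<sigma> v i = (if i = 0 then G else \<sigma> (map v [0..<i]))"

text \<open>
  The runner can always stay in place, so every finite play extends to an infinite one.  It is
  therefore harmless to let plays continue after the flipper has won.
\<close>

definition runner_play ::
    "enat \<Rightarrow> 'a pair_pre_digraph \<Rightarrow> 'a flip_strategy \<Rightarrow> (nat \<Rightarrow> 'a) \<Rightarrow> bool" where
  "runner_play r G \<sigma> v \<longleftrightarrow>
     v 0 \<in> pverts G \<and> (\<forall>i. reach_within r (announced G \<sigma> v i) (v i) (v (Suc i)))"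

definition winning_strategy ::
    "enat \<Rightarrow> nat \<Rightarrow> 'a pair_pre_digraph \<Rightarrow> 'a flip_strategy \<Rightarrow> bool" where
  "winning_strategy r k G \<sigma> \<longleftrightarrow>
     (\<forall>h. k_flip k G (\<sigma> h)) \<and>
     (\<forall>v. runner_play r G \<sigma> v \<longrightarrow> (\<exists>i\<ge>1. isolated (announced G \<sigma> v i) (v i)))"

text \<open>
  The minimum is attained whenever \<open>G\<close> is finite: for the partition into singletons the flipper
  can announce the edgeless graph.
\<close>

definition flip_width :: "enat \<Rightarrow> 'a pair_pre_digraph \<Rightarrow> nat" where
  "flip_width r G = (LEAST k. 1 \<le> k \<and> (\<exists>\<sigma>. winning_strategy r k G \<sigma>))"


section \<open>Induced subgraphs and the excluded graphs\<close>

definition contains_induced :: "'a pair_pre_digraph \<Rightarrow> 'b pair_pre_digraph \<Rightarrow> bool" where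
  "contains_induced G F \<longleftrightarrow>
     (\<exists>H :: 'a pair_pre_digraph.
        induced_subgraph (with_proj H) (with_proj G) \<and> digraph_iso (with_proj F) (with_proj H))"

definition five_vertex_graph :: "nat rel \<Rightarrow> nat pair_pre_digraph" where
  "five_vertex_graph E = \<lparr> pverts = {0, 1, 2, 3, 4}, parcs = E \<union> E\<inverse> \<rparr>"

definition C5_graph :: "nat pair_pre_digraph" where
  "C5_graph = five_vertex_graph {(0, 1), (1, 2), (2, 3), (3, 4), (4, 0)}"

text \<open>Below, $a,b,c,d$ are the vertices $0,1,2,3$, and $v$ is the vertex $4$.\<close>

definition path_abcd :: "nat rel" where
  "path_abcd = {(0, 1), (1, 2), (2, 3)}"

definition bull_graph :: "nat pair_pre_digraph" where
  "bull_graph = five_vertex_graph (path_abcd \<union> {(4, 1), (4, 2)})"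

definition gem_graph :: "nat pair_pre_digraph" where
  "gem_graph = five_vertex_graph (path_abcd \<union> {(4, 0), (4, 1), (4, 2), (4, 3)})"

definition cogem_graph :: "nat pair_pre_digraph" where
  "cogem_graph = five_vertex_graph path_abcd"

lemma pair_graph_five_vertex_graph:
  assumes "E \<subseteq> {0, 1, 2, 3, 4} \<times> {0, 1, 2, 3, 4}" and "irrefl E"
  shows "pair_graph (five_vertex_graph E)"
proof -
  have "finite E"
    using assms(1) by (rule finite_subset) simp
  then show ?thesis
    using assms
    by unfold_locales
      (auto simp: five_vertex_graph_def symmetric_def irrefl_def intro: sym_Un_converse)
qed

lemma
  shows pair_graph_C5: "pair_graph C5_graph"
    and pair_graph_bull: "pair_graph bull_graph"
    and pair_graph_gem: "pair_graph gem_graph"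
    and pair_graph_cogem: "pair_graph cogem_graph"
  unfolding C5_graph_def bull_graph_def gem_graph_def cogem_graph_def path_abcd_def
  by (rule pair_graph_five_vertex_graph; auto simp: irrefl_def)+

end

(*
  The four excluded graphs form the Seidel switching class of C5.  So if none of them is induced,
  switching G so that a vertex v0 becomes isolated leaves a cograph, since an induced P4 would form
  with v0 a co-gem.  Switchings of G and their complements are 2-flips of G, and they allow
  the flipper to isolate any module M of the switched cograph, complementing it or not; as M or its
  complement is disconnected, the runner then gets confined to a proper submodule.  Conversely, in
  every 2-flip of an excluded graph at most one vertex besides the vertex 4 is isolated, and the
  component of 4 never has exactly two vertices.  So two vertices other than 4 lie within distance 2
  of a non-isolated vertex, and one of them is not isolated in the next flip.
*)

theory Submission
  imports Defs
begin

section \<open>Edge parity in flips, switchings as 2-flips, and 2-flips as two-colourings\<close>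

section \<open>Flips\<close>

lemma (in pair_sym_digraph) parcs_sym: "(v, u) \<in> parcs G \<longleftrightarrow> (u, v) \<in> parcs G"
  using pair_sym_arcs by (auto simp: symmetric_def dest: symD)

lemma pverts_flip [simp]: "pverts (flip G A B) = pverts G"
  by (simp add: flip_def)

lemma flips_Nil [simp]: "flips G [] = G"
  by (simp add: flips_def)

lemma flips_snoc [simp]: "flips G (S @ [(A, B)]) = flip (flips G S) A B"
  by (simp add: flips_def)

lemma pverts_flips [simp]: "pverts (flips G S) = pverts G"
proof (induction S rule: rev_induct)
  case (snoc x S)
  then show ?case by (cases x) simp
qed simp

text \<open>Each listed pair toggles the vertex pairs it covers, so only the parity of the covering
  pairs matters. This also makes the order of the flips irrelevant.\<close>

lemma parcs_flips:
  assumes "pair_loopfree_digraph G"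
  shows "(u, v) \<in> parcs (flips G S) \<longleftrightarrow> u \<in> pverts G \<and> v \<in> pverts G \<and> u \<noteq> v \<and>
    (((u, v) \<in> parcs G) \<noteq> odd (length (filter (\<lambda>(A, B). (u, v) \<in> A \<times> B \<union> B \<times> A) S)))"
proof -
  interpret pair_loopfree_digraph G by fact
  show ?thesis
  proof (induction S rule: rev_induct)
    case Nil
    then show ?case
      by (auto dest: in_arcsD1 in_arcsD2 no_loops')
  next
    case (snoc x S)
    obtain A B where x: "x = (A, B)" by force
    show ?case
      unfolding x flips_snoc by (simp add: flip_def snoc) blast
  qed
qed

lemma k_flipD_pverts: "k_flip k G H \<Longrightarrow> pverts H = pverts G"
  by (auto simp: k_flip_def partition_flip_def)

lemma k_flip_arcD:
  assumes "pair_loopfree_digraph G" "k_flip k G H" "(u, v) \<in> parcs H"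
  shows "u \<in> pverts G" "v \<in> pverts G" "u \<noteq> v"
  using assms(2,3) parcs_flips[OF assms(1)] by (auto simp: k_flip_def partition_flip_def)

lemma k_flip_mono: "k_flip k G H \<Longrightarrow> k \<le> l \<Longrightarrow> k_flip l G H"
  unfolding k_flip_def by (meson le_trans)

lemma k_flip_refl:
  assumes "k \<ge> 1"
  shows "k_flip k G G"
proof -
  have "partition_on (pverts G) ({pverts G} - {{}})"
    by (auto simp: partition_on_def disjoint_def)
  moreover have "card ({pverts G} - {{}}) \<le> k"
    using assms card_mono[of "{pverts G}" "{pverts G} - {{}}"] by auto
  moreover have "partition_flip ({pverts G} - {{}}) G G"
    unfolding partition_flip_def by (rule exI[of _ "[]"]) simp
  ultimately show ?thesis
    unfolding k_flip_def by blast
qed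

text \<open>For \<open>b\<close> false this is Seidel switching at \<open>X\<close>, which flips the
  two sides against each other; for \<open>b\<close> true it is the complement of that switching,
  which flips each side with itself.\<close>

lemma switch_is_2_flip:
  assumes "pair_loopfree_digraph G"
  obtains H where "k_flip 2 G H" "\<And>u v. u \<in> pverts G \<Longrightarrow> v \<in> pverts G \<Longrightarrow>
    (u, v) \<in> parcs H \<longleftrightarrow> u \<noteq> v \<and> (((u, v) \<in> parcs G) \<noteq> (((u \<in> X) \<noteq> (v \<in> X)) \<noteq> b))"
proof -
  define A B where "A = pverts G \<inter> X" and "B = pverts G - X"
  \<comment> \<open>Blocks of a partition are nonempty, so pairs with an empty side are dropped;
    flipping them would change nothing.\<close>
  define S where "S = filter (\<lambda>(C, D). C \<noteq> {} \<and> D \<noteq> {}) (if b then [(A, A), (B, B)] else [(A, B)])"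
  have "partition_on (pverts G) ({A, B} - {{}})"
    by (auto simp: partition_on_def disjoint_def A_def B_def)
  moreover have "card ({A, B} - {{}}) \<le> 2"
    using card_mono[of "{A, B}" "{A, B} - {{}}"] card_insert_le_m1[of 2 "{B}" A] by force
  moreover have "partition_flip ({A, B} - {{}}) G (flips G S)"
    unfolding partition_flip_def by (rule exI[of _ S]) (auto simp: S_def)
  ultimately have "k_flip 2 G (flips G S)"
    unfolding k_flip_def by blast
  moreover have "(u, v) \<in> parcs (flips G S) \<longleftrightarrow>
      u \<noteq> v \<and> (((u, v) \<in> parcs G) \<noteq> (((u \<in> X) \<noteq> (v \<in> X)) \<noteq> b))"
    if "u \<in> pverts G" "v \<in> pverts G" for u v
    using that unfolding parcs_flips[OF assms] S_def A_def B_def by auto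
  ultimately show ?thesis by (rule that)
qed

text \<open>Whether a vertex pair is toggled depends only on the parts of its ends, and two parts
  can be told apart by one Boolean. This reduces any 2-flip to finite data for the runner's case
  check.\<close>

lemma k_flip_two_coloring:
  assumes "pair_graph G" "k_flip 2 G H"
  shows "\<exists>(c :: 'a \<Rightarrow> bool) (f :: bool \<Rightarrow> bool \<Rightarrow> bool). (\<forall>p q. f p q = f q p) \<and>
    (\<forall>u\<in>pverts G. \<forall>v\<in>pverts G.
      (u, v) \<in> parcs H \<longleftrightarrow> u \<noteq> v \<and> (((u, v) \<in> parcs G) \<noteq> f (c u) (c v)))"
proof -
  interpret pair_graph G by fact
  obtain P S where P: "partition_on (pverts G) P" "card P \<le> 2"
    and S: "set S \<subseteq> P \<times> P" "H = flips G S"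
    using assms(2) unfolding k_flip_def partition_flip_def by blast
  have "finite P"
    using P(1) pair_finite_verts by (rule finite_elements[rotated])
  \<comment> \<open>\<open>X\<close> is one of at most two parts, so membership in \<open>X\<close>
    determines the part of a vertex. If \<open>P\<close> is empty, any set serves.\<close>
  obtain X where X: "\<And>Y Z. Y \<in> P \<Longrightarrow> Z \<in> P \<Longrightarrow> Y \<noteq> X \<Longrightarrow> Z \<noteq> X \<Longrightarrow> Y = Z" "X \<in> P \<or> P = {}"
  proof (cases "P = {}")
    case False
    then obtain X where "X \<in> P" by blast
    then have "card (P - {X}) \<le> 1"
      using P(2) \<open>finite P\<close> by simp
    then have "Y = Z" if "Y \<in> P - {X}" "Z \<in> P - {X}" for Y Z
      using that \<open>finite P\<close> card_le_Suc0_iff_eq[of "P - {X}"] by auto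
    then show thesis
      using \<open>X \<in> P\<close> by (intro that[of X]) auto
  qed (use that in auto)
  define c where "c u \<longleftrightarrow> u \<in> X" for u
  define t where "t u v \<longleftrightarrow> odd (length (filter (\<lambda>(A, B). (u, v) \<in> A \<times> B \<union> B \<times> A) S))" for u v
  \<comment> \<open>\<open>f\<close> reads the toggle off any representatives of the two colours;
    \<open>t_cong\<close> shows that the choice does not matter. A colour that no vertex has yields
    False.\<close>
  define f where "f p q \<longleftrightarrow> (\<exists>u\<in>pverts G. \<exists>v\<in>pverts G. c u = p \<and> c v = q \<and> t u v)" for p q
  have same_part: "u \<in> A \<longleftrightarrow> u' \<in> A"
    if "A \<in> P" and u: "u \<in> pverts G" "u' \<in> pverts G" and "c u = c u'" for A u u'
  proof -
    obtain Y Y' where Y: "Y \<in> P" "u \<in> Y" "Y' \<in> P" "u' \<in> Y'"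
      using P(1) u unfolding partition_on_def by blast
    have uniq: "Z = Z'" if "Z \<in> P" "Z' \<in> P" "w \<in> Z" "w \<in> Z'" for Z Z' w
      using that P(1) by (auto simp: partition_on_def disjoint_def)
    have "X \<in> P" using X(2) \<open>A \<in> P\<close> by blast
    then have "Y = Y'"
      using X(1) Y \<open>c u = c u'\<close> uniq unfolding c_def by metis
    then show ?thesis
      using Y \<open>A \<in> P\<close> uniq by metis
  qed
  have t_cong: "t u v = t u' v'"
    if "u \<in> pverts G" "u' \<in> pverts G" "c u = c u'" "v \<in> pverts G" "v' \<in> pverts G" "c v = c v'"
    for u u' v v'
  proof -
    have "filter (\<lambda>(A, B). (u, v) \<in> A \<times> B \<union> B \<times> A) S =
          filter (\<lambda>(A, B). (u', v') \<in> A \<times> B \<union> B \<times> A) S"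
      using S(1) same_part[OF _ that(1-3)] same_part[OF _ that(4-6)]
      by (intro filter_cong refl) (clarsimp, blast)
    then show ?thesis unfolding t_def by simp
  qed
  have t_sym: "t u v = t v u" for u v
  proof -
    have "(\<lambda>(A, B). (u, v) \<in> A \<times> B \<union> B \<times> A) = (\<lambda>(A, B). (v, u) \<in> A \<times> B \<union> B \<times> A)"
      by auto
    then show ?thesis unfolding t_def by simp
  qed
  show ?thesis
  proof (intro exI conjI allI ballI)
    show "f p q = f q p" for p q
      unfolding f_def using t_sym by blast
    fix u v assume uv: "u \<in> pverts G" "v \<in> pverts G"
    then have "f (c u) (c v) \<longleftrightarrow> t u v"
      unfolding f_def using t_cong by blast
    then show "(u, v) \<in> parcs H \<longleftrightarrow> u \<noteq> v \<and> (((u, v) \<in> parcs G) \<noteq> f (c u) (c v))"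
      using uv unfolding S(2) parcs_flips[OF pair_loopfree_digraph_axioms] t_def by blast
  qed
qed

text \<open>Flipping the singletons of the two ends of an edge deletes exactly that edge, so
  repetition removes all edges. It follows that some width suffices for the flipper.\<close>

lemma edgeless_singleton_flip:
  assumes "pair_graph G"
  obtains H where "k_flip (card (pverts G)) G H" "parcs H = {}"
proof -
  interpret pair_graph G by fact
  define P where "P = (\<lambda>x. {x}) ` pverts G"
  have "\<exists>S. set S \<subseteq> P \<times> P \<and> parcs (flips G S) = {}"
  proof -
    have "\<exists>S'. set S' \<subseteq> P \<times> P \<and> parcs (flips G S') = {}" if "set S \<subseteq> P \<times> P" for S
      using that
    proof (induction "card (parcs (flips G S))" arbitrary: S rule: less_induct)
      case less
      show ?case
      proof (cases "parcs (flips G S) = {}")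
        case False
        then obtain u v where uv: "(u, v) \<in> parcs (flips G S)" by auto
        let ?S = "S @ [({u}, {v})]"
        note arcs = parcs_flips[OF pair_loopfree_digraph_axioms]
        have "parcs (flips G S) \<subseteq> pverts G \<times> pverts G"
          using arcs by auto
        then have fin: "finite (parcs (flips G S))"
          using pair_finite_verts finite_subset by blast
        have sub: "parcs (flips G ?S) \<subseteq> parcs (flips G S)"
        proof (rule subrelI)
          fix x y assume xy: "(x, y) \<in> parcs (flips G ?S)"
          have sym: "(b, a) \<in> parcs (flips G S)" if "(a, b) \<in> parcs (flips G S)" for a b
          proof -
            have "(\<lambda>(A, B). (a, b) \<in> A \<times> B \<union> B \<times> A) = (\<lambda>(A, B). (b, a) \<in> A \<times> B \<union> B \<times> A)"
              by auto
            then show ?thesis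
              using that parcs_sym[of a b] unfolding arcs by auto
          qed
          show "(x, y) \<in> parcs (flips G S)"
          proof (cases "(x, y) = (u, v) \<or> (x, y) = (v, u)")
            case True
            then show ?thesis using uv sym by blast
          next
            case False
            then show ?thesis using xy unfolding arcs by auto
          qed
        qed
        have "(u, v) \<notin> parcs (flips G ?S)"
          using uv unfolding arcs by auto
        then have "card (parcs (flips G ?S)) < card (parcs (flips G S))"
          using sub uv fin by (intro psubset_card_mono) auto
        moreover have "set ?S \<subseteq> P \<times> P"
          using less.prems uv unfolding arcs P_def by auto
        ultimately show ?thesis
          using less.hyps by blast
      qed (use less.prems in blast)
    qed
    from this[of "[]"] show ?thesis by simp
  qed
  then obtain S where S: "set S \<subseteq> P \<times> P" "parcs (flips G S) = {}" by blast
  have "partition_on (pverts G) P"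
    by (auto simp: P_def partition_on_def disjoint_def)
  moreover have "card P \<le> card (pverts G)"
    unfolding P_def using pair_finite_verts by (rule card_image_le)
  ultimately have "k_flip (card (pverts G)) G (flips G S)"
    unfolding k_flip_def partition_flip_def using S(1) by blast
  then show thesis using S(2) that by blast
qed


section \<open>Reachability, backward induction and the existence of the flip-width\<close>

section \<open>The flipper game\<close>

text \<open>Induction along the path. The flipper's side uses reachability only through this fact,
  which covers every radius at once.\<close>

lemma reach_within_closed:
  assumes "reach_within r H u v" "u \<in> M" "\<And>x y. x \<in> M \<Longrightarrow> (x, y) \<in> parcs H \<Longrightarrow> y \<in> M"
  shows "v \<in> M"
proof -
  obtain p where p: "pre_digraph.apath (with_proj H) u p v"
    using assms(1) unfolding reach_within_def by blast
  have "set p \<subseteq> parcs H" "pcas u p v"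
    using p unfolding pre_digraph.apath_def pre_digraph.awalk_def by (auto simp: cas_with_proj_eq)
  then show ?thesis
    using assms(2,3) by (induction p arbitrary: u) auto
qed

text \<open>The runner never needs a path longer than two, which is where \<open>2 \<le> r\<close>
  enters.\<close>

lemma reach_within_2:
  assumes "2 \<le> r" "u \<in> pverts H"
    and "u = v \<or> (u, v) \<in> parcs H \<or> (\<exists>w. (u, w) \<in> parcs H \<and> (w, v) \<in> parcs H)"
    and "\<And>x y. (x, y) \<in> parcs H \<Longrightarrow> x \<noteq> y \<and> y \<in> pverts H"
  shows "reach_within r H u v"
proof -
  have apathI: "reach_within r H u v"
    if "set p \<subseteq> parcs H" "pcas u p v" "distinct (pawalk_verts u p)" "length p \<le> 2" for p
  proof -
    have "enat (length p) \<le> 2"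
      using that(4) by (simp add: numeral_eq_enat)
    then have "enat (length p) \<le> r"
      using assms(1) by (rule order_trans)
    then show ?thesis
      unfolding reach_within_def pre_digraph.apath_def pre_digraph.awalk_def
      using assms(2) that(1-3)
      by (intro exI[of _ p]) (auto simp: cas_with_proj_eq awalk_verts_with_proj_eq)
  qed
  \<comment> \<open>An \<open>apath\<close> repeats no vertex, so \<open>u = v\<close> is treated
    separately, with the empty path.\<close>
  consider "u = v" | "u \<noteq> v" "(u, v) \<in> parcs H"
    | w where "u \<noteq> v" "(u, w) \<in> parcs H" "(w, v) \<in> parcs H"
    using assms(3) by blast
  then show ?thesis
  proof cases
    case 1
    then show ?thesis using apathI[of "[]"] by simp
  next
    case 2
    then show ?thesis using apathI[of "[(u, v)]"] by simp
  next
    case (3 w)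
    then show ?thesis using apathI[of "[(u, w), (w, v)]"] assms(4) by auto
  qed
qed

context
  fixes r :: enat and k :: nat and G :: "'a pair_pre_digraph"
begin

text \<open>Backward induction for the flipper: a position consists of the graph announced last and
  the runner's vertex, and the number bounds the rounds still to be played.\<close>

primrec winning_in :: "nat \<Rightarrow> 'a pair_pre_digraph \<Rightarrow> 'a \<Rightarrow> bool" where
  "winning_in 0 H v \<longleftrightarrow> isolated H v"
| "winning_in (Suc n) H v \<longleftrightarrow> isolated H v \<or>
     (\<exists>H'. k_flip k G H' \<and> (\<forall>w. reach_within r H v w \<longrightarrow> winning_in n H' w))"

lemma winning_in_mono:
  assumes "winning_in m H v" "m \<le> n"
  shows "winning_in n H v"
proof -
  have "winning_in n H v \<Longrightarrow> winning_in (Suc n) H v" for n H v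
  proof (induction n arbitrary: H v)
    case (Suc n)
    then show ?case unfolding winning_in.simps(2)[of "Suc n"] winning_in.simps(2)[of n] by blast
  qed simp
  with assms(2) show ?thesis
    by (induction rule: dec_induct) (use assms(1) in auto)
qed

text \<open>In a winning position the flipper picks a flip that lowers the least bound on the
  remaining rounds, so every play ends. The hypothesis ranges over all vertices because
  \<open>G1\<close> is announced first, wherever the runner starts.\<close>

lemma winning_strategy_if_winning_in:
  assumes "pair_wf_digraph G" "k_flip k G G1" "\<And>v. v \<in> pverts G \<Longrightarrow> winning_in N G1 v"
  obtains \<sigma> where "winning_strategy r k G \<sigma>"
proof -
  interpret pair_wf_digraph G by fact
  \<comment> \<open>The least \<open>n\<close> with \<open>winning_in n H v\<close> ranks the
    position. At a winning position that is not isolated the rank is positive, so subtracting 1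
    lowers it.\<close>
  define good where "good H v H' \<longleftrightarrow> k_flip k G H' \<and>
    (\<forall>w. reach_within r H v w \<longrightarrow> winning_in ((LEAST n. winning_in n H v) - 1) H' w)" for H v H'
  \<comment> \<open>The default \<open>G1\<close> keeps the value a \<open>k\<close>-flip even where
    no good answer exists, as \<open>winning_strategy\<close> demands for every history.\<close>
  define nxt where "nxt H v = (if \<exists>H'. good H v H' then SOME H'. good H v H' else G1)" for H v
  \<comment> \<open>\<open>foldl\<close> recovers the current graph from the visited vertices. The
    start is dropped by \<open>tl\<close> because the first announcement is always
    \<open>G1\<close>.\<close>
  define \<sigma> where "\<sigma> h = foldl nxt G1 (tl h)" for h
  have nxt: "good H v (nxt H v)" if win: "winning_in n H v" and "\<not> isolated H v" for H v n
  proof -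
    define m where "m = (LEAST n. winning_in n H v)"
    have m: "winning_in m H v"
      unfolding m_def using win by (rule LeastI)
    then obtain m' where "m = Suc m'"
      using \<open>\<not> isolated H v\<close> by (cases m) auto
    then have "\<exists>H'. good H v H'"
      using m \<open>\<not> isolated H v\<close> unfolding good_def m_def[symmetric] by auto
    then show ?thesis
      unfolding nxt_def by (simp add: someI_ex)
  qed
  have "k_flip k G H'" if "good H v H'" for H v H'
    using that by (simp add: good_def)
  then have "k_flip k G (nxt H v)" for H v
    unfolding nxt_def using assms(2) someI_ex[of "good H v"] by auto
  then have foldl: "k_flip k G (foldl nxt H vs)" if "k_flip k G H" for H vs
    using that by (induction vs arbitrary: H) auto
  have "\<exists>i\<ge>1. isolated (announced G \<sigma> v i) (v i)" if play: "runner_play r G \<sigma> v" for v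
  proof -
    have step: "announced G \<sigma> v (Suc i) = nxt (announced G \<sigma> v i) (v i)" if "i \<ge> 1" for i
      using that by (simp add: announced_def \<sigma>_def)
    have "winning_in n (announced G \<sigma> v i) (v i) \<Longrightarrow> i \<ge> 1 \<Longrightarrow>
      \<exists>j\<ge>1. isolated (announced G \<sigma> v j) (v j)" for n i
    proof (induction n arbitrary: i rule: less_induct)
      case (less n)
      let ?H = "announced G \<sigma> v i"
      show ?case
      proof (cases "isolated ?H (v i)")
        case False
        let ?m = "LEAST n. winning_in n ?H (v i)"
        have "winning_in (?m - 1) (announced G \<sigma> v (Suc i)) (v (Suc i))"
          using nxt[OF less.prems(1) False] play step[OF less.prems(2)]
          unfolding good_def runner_play_def by simp
        moreover have "?m \<le> n"
          using less.prems(1) by (rule Least_le)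
        moreover have "?m \<noteq> 0"
          using LeastI[of "\<lambda>n. winning_in n ?H (v i)", OF less.prems(1)] False
          by (metis winning_in.simps(1))
        ultimately show ?thesis
          using less.IH[of "?m - 1" "Suc i"] by simp
      qed (use less.prems in blast)
    qed
    moreover have "winning_in N (announced G \<sigma> v 1) (v 1)"
    proof -
      have "v 0 \<in> pverts G" "reach_within r G (v 0) (v 1)"
        using play unfolding runner_play_def announced_def by (auto dest: spec[of _ 0])
      then have "v 1 \<in> pverts G"
        using reach_within_closed in_arcsD2 by metis
      then show ?thesis
        using assms(3) by (simp add: announced_def \<sigma>_def)
    qed
    ultimately show ?thesis by blast
  qed
  then have "winning_strategy r k G \<sigma>"
    unfolding winning_strategy_def using foldl assms(2) by (simp add: \<sigma>_def)
  then show thesis by (rule that)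
qed

end

text \<open>\<open>flip_width\<close> is a \<open>LEAST\<close>, so some winning width must exist
  first: the edgeless singleton flip wins at once. A strategy also stays winning when the width
  grows.\<close>

lemma flip_width_le_iff:
  assumes "pair_graph G" "k \<ge> 1"
  shows "flip_width r G \<le> k \<longleftrightarrow> (\<exists>\<sigma>. winning_strategy r k G \<sigma>)"
proof
  interpret pair_graph G by fact
  define Q where "Q k \<longleftrightarrow> 1 \<le> k \<and> (\<exists>\<sigma>. winning_strategy r k G \<sigma>)" for k
  obtain H where H: "k_flip (card (pverts G)) G H" "parcs H = {}"
    using assms(1) by (rule edgeless_singleton_flip)
  \<comment> \<open>The maximum covers the empty graph, since widths are at least 1.\<close>
  then have flip: "k_flip (max 1 (card (pverts G))) G H"
    by (meson k_flip_mono max.cobounded2)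
  moreover have "winning_in r (max 1 (card (pverts G))) G 0 H v" if "v \<in> pverts G" for v
    using that H(2) k_flipD_pverts[OF H(1)] by (simp add: isolated_def)
  ultimately obtain \<tau> where "winning_strategy r (max 1 (card (pverts G))) G \<tau>"
    using winning_strategy_if_winning_in[OF pair_wf_digraph] by blast
  then have "Q (max 1 (card (pverts G)))"
    unfolding Q_def by auto
  then have "Q (flip_width r G)"
    unfolding flip_width_def Q_def[symmetric] by (rule LeastI)
  then obtain \<sigma> where "winning_strategy r (flip_width r G) G \<sigma>"
    unfolding Q_def by blast
  moreover assume "flip_width r G \<le> k"
  ultimately show "\<exists>\<sigma>. winning_strategy r k G \<sigma>"
    unfolding winning_strategy_def by (meson k_flip_mono)
next
  assume "\<exists>\<sigma>. winning_strategy r k G \<sigma>"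
  then show "flip_width r G \<le> k"
    unfolding flip_width_def using assms(2) by (intro Least_le) auto
qed


section \<open>Splitting cographs into two parts\<close>

section \<open>The flipper wins on switched cographs\<close>

definition P4_free_on :: "'a set \<Rightarrow> ('a \<Rightarrow> 'a \<Rightarrow> bool) \<Rightarrow> bool" where
  "P4_free_on M R \<longleftrightarrow> (\<forall>p\<in>M. \<forall>q\<in>M. \<forall>r\<in>M. \<forall>s\<in>M. distinct [p, q, r, s] \<longrightarrow>
     \<not> (R p q \<and> R q r \<and> R r s \<and> \<not> R p r \<and> \<not> R q s \<and> \<not> R p s))"

lemma P4_free_on_subset: "P4_free_on M R \<Longrightarrow> N \<subseteq> M \<Longrightarrow> P4_free_on N R"
  unfolding P4_free_on_def by blast

lemma P4_free_onD:
  "\<lbrakk>P4_free_on M R; R p q; R q r; R r s; \<not> R p r; \<not> R q s; \<not> R p s;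
    p \<in> M; q \<in> M; r \<in> M; s \<in> M; distinct [p, q, r, s]\<rbrakk> \<Longrightarrow> False"
  unfolding P4_free_on_def by blast

text \<open>The path on four vertices is self-complementary: if \<open>p q r s\<close> is one in the
  complement, then \<open>r p s q\<close> is one in \<open>R\<close>. Loops of the complement do no
  harm, as \<open>P4_free_on\<close> asks for distinct vertices.\<close>

lemma P4_free_on_complement:
  assumes "symp R" "P4_free_on M R"
  shows "P4_free_on M (\<lambda>x y. \<not> R x y)"
  unfolding P4_free_on_def
proof (intro ballI impI notI)
  fix p q r s
  assume "p \<in> M" "q \<in> M" "r \<in> M" "s \<in> M" "distinct [p, q, r, s]"
    and "\<not> R p q \<and> \<not> R q r \<and> \<not> R r s \<and> \<not> \<not> R p r \<and> \<not> \<not> R q s \<and> \<not> \<not> R p s"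
  then show False
    using P4_free_onD[OF assms(2), of r p s q] sympD[OF assms(1)] by auto
qed

definition anticomplete_split :: "'a set \<Rightarrow> ('a \<Rightarrow> 'a \<Rightarrow> bool) \<Rightarrow> 'a set \<Rightarrow> 'a set \<Rightarrow> bool" where
  "anticomplete_split M R S T \<longleftrightarrow> M = S \<union> T \<and> S \<inter> T = {} \<and> S \<noteq> {} \<and> T \<noteq> {} \<and>
     (\<forall>s\<in>S. \<forall>t\<in>T. \<not> R s t)"

text \<open>Unless \<open>x\<close> is joined to all of \<open>M\<close>, it has a non-neighbour
  \<open>y\<close>, with component \<open>C\<close>. If \<open>x\<close> had neighbours both inside
  and outside \<open>C\<close>, an edge of \<open>C\<close> from a non-neighbour to a neighbour of
  \<open>x\<close> would extend through \<open>x\<close> to an induced path on four vertices. So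
  \<open>C\<close> or \<open>M - C\<close> splits off.\<close>

lemma P4_free_split_insert:
  assumes "finite M" "symp R" "x \<notin> M" "P4_free_on (insert x M) R" "anticomplete_split M R S T"
  shows "\<exists>S T. anticomplete_split (insert x M) R S T \<or>
    anticomplete_split (insert x M) (\<lambda>x y. \<not> R x y) S T"
proof (cases "\<forall>y\<in>M. R x y")
  case True
  then have "anticomplete_split (insert x M) (\<lambda>x y. \<not> R x y) {x} M"
    using assms(3,5) by (auto simp: anticomplete_split_def)
  then show ?thesis by blast
next
  case False
  then obtain y where y: "y \<in> M" "\<not> R x y" by blast
  \<comment> \<open>A \<open>closed\<close> set is a proper union of components of \<open>M\<close>
    that contains \<open>y\<close>; a smallest one serves as the component of
    \<open>y\<close>.\<close>
  define closed where
    "closed C \<longleftrightarrow> y \<in> C \<and> C \<subset> M \<and> (\<forall>c\<in>C. \<forall>d\<in>M - C. \<not> R c d)" for C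
  have "closed S \<or> closed T"
    using assms(5) y(1) sympD[OF assms(2)] unfolding closed_def anticomplete_split_def by blast
  then obtain C where C: "closed C" and least: "\<And>D. closed D \<Longrightarrow> card C \<le> card D"
    using ex_has_least_nat[of closed _ card] by blast
  have "C \<subseteq> M" "y \<in> C"
    using C by (auto simp: closed_def)
  show ?thesis
  proof (cases "\<exists>c\<in>C. R x c")
    case False
    then have "anticomplete_split (insert x M) R C (insert x (M - C))"
      using C assms(3) sympD[OF assms(2)] by (auto simp: closed_def anticomplete_split_def)
    then show ?thesis by blast
  next
    case True
    define C1 where "C1 = {c \<in> C. \<not> R x c}"
    have "C1 \<subset> C"
      using True by (auto simp: C1_def)
    then have "card C1 < card C"
      using assms(1) \<open>C \<subseteq> M\<close> by (meson finite_subset psubset_card_mono)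
    then have "\<not> closed C1"
      using least by (meson not_le)
    \<comment> \<open>\<open>C1\<close> contains \<open>y\<close> and is proper, so it can only fail
      to be closed through an arc leaving it. As \<open>C\<close> is closed, that arc ends in
      \<open>C\<close>, at a neighbour of \<open>x\<close>.\<close>
    then obtain c1 c2 where c: "c1 \<in> C1" "c2 \<in> M - C1" "R c1 c2"
      using \<open>C1 \<subset> C\<close> \<open>C \<subseteq> M\<close> y \<open>y \<in> C\<close> by (auto simp: closed_def C1_def)
    then have c2: "c2 \<in> C" "R x c2"
      using C by (auto simp: closed_def C1_def)
    have "\<not> R x d" if "d \<in> M - C" for d
    proof
      assume "R x d"
      moreover have "\<not> R c1 d" "\<not> R c2 d"
        using C c(1) c2(1) that by (auto simp: closed_def C1_def)
      moreover have "\<not> R c1 x" "R c2 x"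
        using c(1) c2(2) sympD[OF assms(2)] by (auto simp: C1_def)
      ultimately show False
        using P4_free_onD[OF assms(4), of c1 c2 x d] c c2 that \<open>C \<subseteq> M\<close> assms(3)
        by (auto simp: C1_def)
    qed
    then have "anticomplete_split (insert x M) R (insert x C) (M - C)"
      using C assms(3) by (auto simp: closed_def anticomplete_split_def)
    then show ?thesis by blast
  qed
qed

text \<open>Seinsche's theorem on cographs, by adding one vertex at a time. If the smaller set
  splits in the complement, the insertion step is applied to the complement.\<close>

lemma P4_free_split:
  assumes "finite M" "2 \<le> card M" "symp R" "P4_free_on M R"
  shows "\<exists>S T. anticomplete_split M R S T \<or> anticomplete_split M (\<lambda>x y. \<not> R x y) S T"
  using assms(1,2,4)
proof (induction M rule: finite_induct)
  case (insert x M)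
  show ?case
  proof (cases "2 \<le> card M")
    case True
    have co: "symp (\<lambda>x y. \<not> R x y)"
      using assms(3) by (auto simp: symp_def)
    have "P4_free_on M R"
      using insert.prems(2) by (rule P4_free_on_subset) blast
    then obtain S T where
      "anticomplete_split M R S T \<or> anticomplete_split M (\<lambda>x y. \<not> R x y) S T"
      using insert.IH True by blast
    then show ?thesis
    proof
      assume "anticomplete_split M R S T"
      then show ?thesis
        using P4_free_split_insert insert assms(3) by metis
    next
      assume "anticomplete_split M (\<lambda>x y. \<not> R x y) S T"
      from P4_free_split_insert[OF insert.hyps(1) co insert.hyps(2)
          P4_free_on_complement[OF assms(3) insert.prems(2)] this]
      show ?thesis by auto
    qed
  next
    case False
    then have "card M = 1"
      using insert by simp
    then obtain y where "M = {y}"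
      by (auto simp: card_1_singleton_iff)
    then have "anticomplete_split (insert x M) R {x} {y} \<or>
        anticomplete_split (insert x M) (\<lambda>x y. \<not> R x y) {x} {y}"
      using insert.hyps(2) by (auto simp: anticomplete_split_def)
    then show ?thesis by blast
  qed
qed simp

section \<open>Modules of the switched cograph and the flipper's strategy\<close>

locale switched_cograph = pair_graph G for G :: "'a pair_pre_digraph" +
  fixes Z :: "'a set" and R :: "'a \<Rightarrow> 'a \<Rightarrow> bool"
  assumes R_sym: "symp R"
    and R_switch: "\<And>u v. u \<in> pverts G \<Longrightarrow> v \<in> pverts G \<Longrightarrow> u \<noteq> v \<Longrightarrow>
      R u v \<longleftrightarrow> (((u, v) \<in> parcs G) \<noteq> ((u \<in> Z) \<noteq> (v \<in> Z)))"
    and P4_free: "P4_free_on (pverts G) R"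
begin

text \<open>These are the homogeneous sets of the switched relation \<open>R\<close>, not of
  \<open>G\<close>; the runner gets trapped in smaller and smaller ones.\<close>

definition module :: "'a set \<Rightarrow> bool" where
  "module M \<longleftrightarrow> M \<subseteq> pverts G \<and> M \<noteq> {} \<and> (\<forall>x\<in>pverts G - M. \<forall>y\<in>M. \<forall>z\<in>M. R y x \<longleftrightarrow> R z x)"

text \<open>Outside vertices do not distinguish the vertices of \<open>M\<close> in
  \<open>R\<close>, so one further switching, at the outside vertices joined to \<open>M\<close>,
  removes all edges leaving \<open>M\<close>. For \<open>b\<close> true the same is done in the
  complement.\<close>

lemma flip_isolating_module:
  assumes "module M"
  obtains H where "k_flip 2 G H" "\<And>u v. u \<in> M \<Longrightarrow>
    (u, v) \<in> parcs H \<longleftrightarrow> v \<in> M \<and> u \<noteq> v \<and> (R u v \<noteq> b)"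
proof -
  obtain m where m: "m \<in> M"
    using assms unfolding module_def by blast
  \<comment> \<open>\<open>W\<close> holds the outside vertices joined to \<open>M\<close> in
    \<open>R\<close>, or in its complement if \<open>b\<close>. Switching at \<open>Z\<close> and
    then at \<open>W\<close> is switching at their symmetric difference.\<close>
  define W where "W = {x \<in> pverts G - M. R m x \<noteq> b}"
  obtain H where H: "k_flip 2 G H" "\<And>u v. u \<in> pverts G \<Longrightarrow> v \<in> pverts G \<Longrightarrow> (u, v) \<in> parcs H \<longleftrightarrow>
      u \<noteq> v \<and> (((u, v) \<in> parcs G) \<noteq> (((u \<in> sym_diff Z W) \<noteq> (v \<in> sym_diff Z W)) \<noteq> b))"
    using switch_is_2_flip[OF pair_loopfree_digraph_axioms] by metis
  have "(u, v) \<in> parcs H \<longleftrightarrow> v \<in> M \<and> u \<noteq> v \<and> (R u v \<noteq> b)" if u: "u \<in> M" for u v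
  proof (cases "v \<in> pverts G")
    case True
    have uV: "u \<in> pverts G" "u \<notin> W" "\<And>x. x \<in> M \<Longrightarrow> x \<notin> W"
      using u assms by (auto simp: module_def W_def)
    show ?thesis
    proof (cases "v \<in> M")
      case True
      then show ?thesis
        using uV R_switch[of u v] H(2)[of u v] \<open>v \<in> pverts G\<close> by auto
    next
      case False
      then have "R u v \<longleftrightarrow> R m v"
        using assms u m \<open>v \<in> pverts G\<close> unfolding module_def by blast
      then have "v \<in> W \<longleftrightarrow> R u v \<noteq> b"
        using False \<open>v \<in> pverts G\<close> by (simp add: W_def)
      then show ?thesis
        using uV False u R_switch[of u v] H(2)[of u v] \<open>v \<in> pverts G\<close> by auto
    qed
  next
    case False
    then have "(u, v) \<notin> parcs H"
      using k_flip_arcD(2)[OF pair_loopfree_digraph_axioms H(1)] by blast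
    then show ?thesis
      using False assms by (auto simp: module_def)
  qed
  then show thesis using H(1) that by blast
qed

text \<open>A vertex outside \<open>S\<close> lies outside \<open>M\<close> or in \<open>T\<close>,
  and the vertices of \<open>T\<close> are joined to all of \<open>S\<close> or to none of
  it.\<close>

lemma module_split:
  assumes "module M" "anticomplete_split M R S T \<or> anticomplete_split M (\<lambda>x y. \<not> R x y) S T"
  shows "module S" "module T"
proof -
  have ST: "M = S \<union> T" "S \<noteq> {}" "T \<noteq> {}"
    using assms(2) by (auto simp: anticomplete_split_def)
  have "(\<forall>s\<in>S. \<forall>t\<in>T. \<not> R s t \<and> \<not> R t s) \<or> (\<forall>s\<in>S. \<forall>t\<in>T. R s t \<and> R t s)"
    using assms(2) sympD[OF R_sym] unfolding anticomplete_split_def by blast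
  then show "module S" "module T"
    using ST assms(1) unfolding module_def by blast+
qed

text \<open>Induction on \<open>card M\<close>. The runner's next vertex is in \<open>M\<close>, so
  the flipper announces a flip that isolates \<open>M\<close> and separates the two halves of a
  split; the move after that stays inside one half, a smaller module.\<close>

lemma winning_in_module:
  assumes "module M" "\<And>w. reach_within r H v w \<Longrightarrow> w \<in> M"
  shows "winning_in r 2 G (card M) H v"
  using assms
proof (induction "card M" arbitrary: M H v rule: less_induct)
  case less
  have M: "finite M" "M \<noteq> {}" "M \<subseteq> pverts G"
    using less.prems(1) finite_subset[OF _ pair_finite_verts] by (auto simp: module_def)
  then obtain n where n: "card M = Suc n"
    by (metis card_0_eq not0_implies_Suc)
  show ?case
  proof (cases "2 \<le> card M")
    case False
    then obtain x where x: "M = {x}" "n = 0"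
      using n by (auto simp: card_Suc_eq)
    \<comment> \<open>The flip isolating \<open>M\<close> leaves its only vertex without arcs, for
      either value of \<open>b\<close>.\<close>
    obtain H' where H': "k_flip 2 G H'" "\<And>w. (x, w) \<notin> parcs H'"
      using flip_isolating_module[OF less.prems(1), of True] x(1) by (metis singletonD singletonI)
    have "isolated H' x"
      using H'(2) M(3) x(1) k_flipD_pverts[OF H'(1)] by (simp add: isolated_def)
    then show ?thesis
      using H'(1) less.prems(2) x by (auto simp: n)
  next
    case True
    then obtain S T where split:
      "anticomplete_split M R S T \<or> anticomplete_split M (\<lambda>x y. \<not> R x y) S T"
      using P4_free_split[OF M(1) _ R_sym P4_free_on_subset[OF P4_free M(3)]] by blast
    then have ST: "M = S \<union> T" "S \<inter> T = {}" "S \<noteq> {}" "T \<noteq> {}"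
      by (auto simp: anticomplete_split_def)
    then have smaller: "card S < card M" "card T < card M"
      using M(1) by (auto intro!: psubset_card_mono)
    \<comment> \<open>\<open>b\<close> tells whether \<open>S\<close> and \<open>T\<close> are
      completely joined in \<open>R\<close>; flipping with this \<open>b\<close> removes every edge
      between them.\<close>
    obtain b where b: "\<And>s t. s \<in> S \<Longrightarrow> t \<in> T \<Longrightarrow> (R s t \<longleftrightarrow> b) \<and> (R t s \<longleftrightarrow> b)"
      using split sympD[OF R_sym] unfolding anticomplete_split_def by metis
    obtain H' where H': "k_flip 2 G H'" "\<And>u w. u \<in> M \<Longrightarrow>
        (u, w) \<in> parcs H' \<longleftrightarrow> w \<in> M \<and> u \<noteq> w \<and> (R u w \<noteq> b)"
      using flip_isolating_module[OF less.prems(1), of b] by metis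
    have "winning_in r 2 G n H' w" if "reach_within r H v w" for w
    proof -
      have "\<exists>D\<in>{S, T}. w \<in> D"
        using less.prems(2)[OF that] ST(1) by blast
      then obtain D where D: "D \<in> {S, T}" "w \<in> D" by blast
      have "w' \<in> D" if "reach_within r H' w w'" for w'
        using that D(2)
      proof (rule reach_within_closed)
        fix x y assume "x \<in> D" "(x, y) \<in> parcs H'"
        then show "y \<in> D"
          using H'(2)[of x y] D(1) ST(1) b by auto
      qed
      moreover have "module D"
        using module_split[OF less.prems(1) split] D(1) by blast
      moreover have "card D < card M"
        using smaller D(1) by blast
      ultimately have "winning_in r 2 G (card D) H' w" "card D \<le> n"
        using less.hyps n by auto
      then show ?thesis by (rule winning_in_mono)
    qed
    then show ?thesis
      using H'(1) by (auto simp: n)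
  qed
qed

text \<open>The whole vertex set is trivially a module, and announcing \<open>G\<close> itself first
  keeps the runner in it.\<close>

lemma flipper_wins:
  obtains \<sigma> where "winning_strategy r 2 G \<sigma>"
proof (rule winning_strategy_if_winning_in)
  show "pair_wf_digraph G" ..
  show "k_flip 2 G G" by (rule k_flip_refl) simp
  fix v assume "v \<in> pverts G"
  then show "winning_in r 2 G (card (pverts G)) G v"
    using reach_within_closed[where M = "pverts G"] in_arcsD2
    by (intro winning_in_module) (auto simp: module_def)
qed (rule that)

end


section \<open>Induced copies as embeddings, and the switching class of \<open>C5\<close>\<close>

section \<open>The excluded graphs\<close>

text \<open>Arcs are pairs of vertices, so an isomorphism acts on arcs through its vertex map; arc
  maps and image graphs can then be avoided.\<close>

lemma contains_induced_iff:
  assumes "pair_wf_digraph G" "pair_wf_digraph F"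
  shows "contains_induced G F \<longleftrightarrow> (\<exists>f. inj_on f (pverts F) \<and> f ` pverts F \<subseteq> pverts G \<and>
    (\<forall>x\<in>pverts F. \<forall>y\<in>pverts F. (f x, f y) \<in> parcs G \<longleftrightarrow> (x, y) \<in> parcs F))"
    (is "_ \<longleftrightarrow> (\<exists>f. ?emb f)")
proof
  interpret F: pair_wf_digraph F by fact
  assume "contains_induced G F"
  then obtain H h where H: "induced_subgraph (with_proj H) (with_proj G)"
    and h: "pre_digraph.digraph_isomorphism (with_proj F) h" "with_proj H = app_iso h (with_proj F)"
    unfolding contains_induced_def digraph_iso_def by blast
  let ?f = "iso_verts h"
  have iso: "iso_tail h = fst" "iso_head h = snd" "?f ` pverts F = pverts H"
      "iso_arcs h ` parcs F = parcs H"
    using h(2) by (metis with_proj_simps app_iso_simps)+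
  have arc: "iso_arcs h (x, y) = (?f x, ?f y)" if "(x, y) \<in> parcs F" for x y
  proof -
    have "?f x = fst (iso_arcs h (x, y))" "?f y = snd (iso_arcs h (x, y))"
      using h(1) that unfolding pre_digraph.digraph_isomorphism_def
      by (auto simp: iso dest!: bspec[of _ _ "(x, y)"])
    then show ?thesis by simp
  qed
  have inj: "inj_on ?f (pverts F)"
    using h(1) unfolding pre_digraph.digraph_isomorphism_def by simp
  have "(?f x, ?f y) \<in> parcs H \<longleftrightarrow> (x, y) \<in> parcs F" if "x \<in> pverts F" "y \<in> pverts F" for x y
  proof
    assume "(?f x, ?f y) \<in> parcs H"
    then obtain x' y' where xy': "(x', y') \<in> parcs F" "(?f x, ?f y) = iso_arcs h (x', y')"
      unfolding iso(4)[symmetric] by force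
    then have "?f x = ?f x'" "?f y = ?f y'"
      using arc by auto
    then have "x = x'" "y = y'"
      using inj that F.in_arcsD1[OF xy'(1)] F.in_arcsD2[OF xy'(1)] by (auto dest: inj_onD)
    then show "(x, y) \<in> parcs F" using xy' by simp
  next
    assume "(x, y) \<in> parcs F"
    then show "(?f x, ?f y) \<in> parcs H"
      unfolding iso(4)[symmetric] by (metis arc imageI)
  qed
  moreover have "pverts H \<subseteq> pverts G" "parcs H = {e \<in> parcs G. fst e \<in> pverts H \<and> snd e \<in> pverts H}"
    using H unfolding induced_subgraph_def subgraph_def by auto
  ultimately have "?emb ?f"
    using inj iso(3)[symmetric] by simp
  then show "\<exists>f. ?emb f" by blast
next
  interpret G: pair_wf_digraph G by fact
  interpret F: pair_wf_digraph F by fact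
  assume "\<exists>f. ?emb f"
  then obtain f where f: "?emb f" by blast
  define H where "H = \<lparr>pverts = f ` pverts F, parcs = {e \<in> parcs G. fst e \<in> f ` pverts F \<and> snd e \<in> f ` pverts F}\<rparr>"
  define h where "h = \<lparr>iso_verts = f, iso_arcs = map_prod f f, iso_head = snd, iso_tail = fst\<rparr>"
  have "pair_wf_digraph H"
    by unfold_locales (auto simp: H_def)
  then have "wf_digraph (with_proj H)"
    by (simp add: wf_digraph_wp_iff)
  then have "induced_subgraph (with_proj H) (with_proj G)"
    using f G.wf_digraph_axioms
    by (auto simp: induced_subgraph_def subgraph_def compatible_def H_def)
  moreover have "map_prod f f ` parcs F = parcs H"
    using f F.in_arcsD1 F.in_arcsD2 by (force simp: H_def image_iff)
  then have "with_proj H = app_iso h (with_proj F)"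
    by (simp add: app_iso_def h_def with_proj_def) (simp add: H_def)
  moreover have "inj_on (map_prod f f) (parcs F)"
    using f F.in_arcsD1 F.in_arcsD2 by (auto simp: inj_on_def)
  then have "pre_digraph.digraph_isomorphism (with_proj F) h"
    using f F.wf_digraph_axioms unfolding pre_digraph.digraph_isomorphism_def h_def by simp
  ultimately show "contains_induced G F"
    unfolding contains_induced_def digraph_iso_def by blast
qed

text \<open>Ten adjacencies suffice because symmetry and the absence of loops settle the other
  pairs. In this form the simplifier can check a proposed copy.\<close>

lemma contains_induced_five_vertexI:
  assumes "pair_graph G" "pair_graph (five_vertex_graph E)"
    and "distinct [a, b, c, d, e]" "{a, b, c, d, e} \<subseteq> pverts G"
    and "(a, b) \<in> parcs G \<longleftrightarrow> (0, 1) \<in> E \<union> E\<inverse>" "(a, c) \<in> parcs G \<longleftrightarrow> (0, 2) \<in> E \<union> E\<inverse>"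
      "(a, d) \<in> parcs G \<longleftrightarrow> (0, 3) \<in> E \<union> E\<inverse>" "(a, e) \<in> parcs G \<longleftrightarrow> (0, 4) \<in> E \<union> E\<inverse>"
      "(b, c) \<in> parcs G \<longleftrightarrow> (1, 2) \<in> E \<union> E\<inverse>" "(b, d) \<in> parcs G \<longleftrightarrow> (1, 3) \<in> E \<union> E\<inverse>"
      "(b, e) \<in> parcs G \<longleftrightarrow> (1, 4) \<in> E \<union> E\<inverse>" "(c, d) \<in> parcs G \<longleftrightarrow> (2, 3) \<in> E \<union> E\<inverse>"
      "(c, e) \<in> parcs G \<longleftrightarrow> (2, 4) \<in> E \<union> E\<inverse>" "(d, e) \<in> parcs G \<longleftrightarrow> (3, 4) \<in> E \<union> E\<inverse>"
  shows "contains_induced G (five_vertex_graph E)"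
proof -
  interpret G: pair_graph G by fact
  interpret F: pair_graph "five_vertex_graph E" by fact
  define f where "f = (!) [a, b, c, d, e]"
  have f: "f 0 = a" "f (Suc 0) = b" "f 2 = c" "f 3 = d" "f 4 = e"
    by (simp_all add: f_def)
  define E' where "E' = E \<union> E\<inverse>"
  have E'_sym: "(j, i) \<in> E' \<longleftrightarrow> (i, j) \<in> E'" for i j
    by (auto simp: E'_def)
  have loop: "(u, u) \<notin> parcs G" "(i, i) \<notin> E'" for u i
    using G.no_loops'[of u u] F.no_loops'[of i i] by (auto simp: five_vertex_graph_def E'_def)
  have "(f i, f j) \<in> parcs G \<longleftrightarrow> (i, j) \<in> E'" if "i \<in> {0, 1, 2, 3, 4}" "j \<in> {0, 1, 2, 3, 4}" for i j
    using that assms(5-)[folded E'_def]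
    by (elim insertE emptyE) (simp_all add: f G.parcs_sym E'_sym loop)
  moreover have "inj_on f {0, 1, 2, 3, 4}" "f ` {0, 1, 2, 3, 4} \<subseteq> pverts G"
    using assms(3,4) by (auto simp: f)
  ultimately show ?thesis
    unfolding contains_induced_iff[OF G.pair_wf_digraph F.pair_wf_digraph]
    by (intro exI[of _ f]) (simp add: five_vertex_graph_def E'_def[symmetric])
qed

text \<open>Every switching of the co-gem is one of the four excluded graphs. An induced path
  \<open>p q r s\<close> of \<open>R\<close> forms a co-gem with the isolated \<open>v0\<close>, so
  \<open>G\<close> on these five vertices would be excluded.\<close>

lemma switched_cograph_if_free:
  assumes "pair_graph G" "v0 \<in> pverts G"
    and "\<not> contains_induced G C5_graph" "\<not> contains_induced G bull_graph"
      "\<not> contains_induced G gem_graph" "\<not> contains_induced G cogem_graph"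
  obtains Z R where "switched_cograph G Z R"
proof -
  interpret pair_graph G by fact
  \<comment> \<open>Switching at the neighbourhood of \<open>v0\<close> isolates
    \<open>v0\<close>.\<close>
  define Z where "Z = {u. (v0, u) \<in> parcs G}"
  define R where "R u v \<longleftrightarrow> (((u, v) \<in> parcs G) \<noteq> ((u \<in> Z) \<noteq> (v \<in> Z)))" for u v
  have isolated: "\<not> R v0 u" "\<not> R u v0" for u
    using no_loops'[of v0 v0] by (auto simp: R_def Z_def parcs_sym)
  have "P4_free_on (pverts G) R"
    unfolding P4_free_on_def
  proof (intro ballI impI notI)
    fix p q r s
    assume V: "p \<in> pverts G" "q \<in> pverts G" "r \<in> pverts G" "s \<in> pverts G"
      and dist: "distinct [p, q, r, s]"
      and P4: "R p q \<and> R q r \<and> R r s \<and> \<not> R p r \<and> \<not> R q s \<and> \<not> R p s"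
    have v0: "v0 \<notin> {p, q, r, s}" "p \<noteq> v0" "q \<noteq> v0" "r \<noteq> v0" "s \<noteq> v0"
      using P4 isolated by blast+
    \<comment> \<open>The reversed list supplies each disequality in the other orientation for the
      simplifier.\<close>
    have "distinct [s, r, q, p]"
      using dist by auto
    note facts = assms(1,2) V dist this v0 P4[unfolded R_def]
    have Z: "(x, v0) \<in> parcs G \<longleftrightarrow> x \<in> Z" "(v0, x) \<in> parcs G \<longleftrightarrow> x \<in> Z" for x
      by (simp_all add: Z_def parcs_sym)
    note free = assms(3-6)[unfolded C5_graph_def bull_graph_def gem_graph_def cogem_graph_def]
    note pair_graphs = pair_graph_C5 pair_graph_bull pair_graph_gem pair_graph_cogem
    note pair_graphs = pair_graphs[unfolded C5_graph_def bull_graph_def gem_graph_def cogem_graph_def]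
    note C5 = notE[OF free(1) contains_induced_five_vertexI[OF assms(1) pair_graphs(1)]]
      and bull = notE[OF free(2) contains_induced_five_vertexI[OF assms(1) pair_graphs(2)]]
      and gem = notE[OF free(3) contains_induced_five_vertexI[OF assms(1) pair_graphs(3)]]
      and cogem = notE[OF free(4) contains_induced_five_vertexI[OF assms(1) pair_graphs(4)]]
    \<comment> \<open>The 16 memberships in \<open>Z\<close> give all switchings of the path
      together with \<open>v0\<close>. Each case lists the vertices as \<open>a\<close>,
      \<open>b\<close>, \<open>c\<close>, \<open>d\<close>, \<open>v\<close> of the excluded graph
      found, or in cyclic order for \<open>C5\<close>.\<close>
    consider
        "p \<notin> Z \<and> q \<notin> Z \<and> r \<notin> Z \<and> s \<notin> Z"
      | "p \<notin> Z \<and> q \<notin> Z \<and> r \<notin> Z \<and> s \<in> Z"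
      | "p \<notin> Z \<and> q \<notin> Z \<and> r \<in> Z \<and> s \<notin> Z"
      | "p \<notin> Z \<and> q \<notin> Z \<and> r \<in> Z \<and> s \<in> Z"
      | "p \<notin> Z \<and> q \<in> Z \<and> r \<notin> Z \<and> s \<notin> Z"
      | "p \<notin> Z \<and> q \<in> Z \<and> r \<notin> Z \<and> s \<in> Z"
      | "p \<notin> Z \<and> q \<in> Z \<and> r \<in> Z \<and> s \<notin> Z"
      | "p \<notin> Z \<and> q \<in> Z \<and> r \<in> Z \<and> s \<in> Z"
      | "p \<in> Z \<and> q \<notin> Z \<and> r \<notin> Z \<and> s \<notin> Z"
      | "p \<in> Z \<and> q \<notin> Z \<and> r \<notin> Z \<and> s \<in> Z"
      | "p \<in> Z \<and> q \<notin> Z \<and> r \<in> Z \<and> s \<notin> Z"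
      | "p \<in> Z \<and> q \<notin> Z \<and> r \<in> Z \<and> s \<in> Z"
      | "p \<in> Z \<and> q \<in> Z \<and> r \<notin> Z \<and> s \<notin> Z"
      | "p \<in> Z \<and> q \<in> Z \<and> r \<notin> Z \<and> s \<in> Z"
      | "p \<in> Z \<and> q \<in> Z \<and> r \<in> Z \<and> s \<notin> Z"
      | "p \<in> Z \<and> q \<in> Z \<and> r \<in> Z \<and> s \<in> Z"
      by (cases "p \<in> Z"; cases "q \<in> Z"; cases "r \<in> Z"; cases "s \<in> Z") simp_all
    then show False
    proof cases
      case 1
      show False
        by (rule cogem[of p q r s v0]) (use 1 facts in \<open>simp_all add: Z parcs_sym path_abcd_def\<close>)
    next
      case 2
      show False
        by (rule bull[of r q s v0 p]) (use 2 facts in \<open>simp_all add: Z parcs_sym path_abcd_def\<close>)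
    next
      case 3
      show False
        by (rule cogem[of q p r v0 s]) (use 3 facts in \<open>simp_all add: Z parcs_sym path_abcd_def\<close>)
    next
      case 4
      show False
        by (rule gem[of q p r v0 s]) (use 4 facts in \<open>simp_all add: Z parcs_sym path_abcd_def\<close>)
    next
      case 5
      show False
        by (rule cogem[of r s q v0 p]) (use 5 facts in \<open>simp_all add: Z parcs_sym path_abcd_def\<close>)
    next
      case 6
      show False
        by (rule cogem[of p s v0 q r]) (use 6 facts in \<open>simp_all add: Z parcs_sym path_abcd_def\<close>)
    next
      case 7
      show False
        by (rule bull[of p r q s v0]) (use 7 facts in \<open>simp_all add: Z parcs_sym path_abcd_def\<close>)
    next
      case 8
      show False
        by (rule gem[of p s v0 q r]) (use 8 facts in \<open>simp_all add: Z parcs_sym path_abcd_def\<close>)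
    next
      case 9
      show False
        by (rule bull[of q r p v0 s]) (use 9 facts in \<open>simp_all add: Z parcs_sym path_abcd_def\<close>)
    next
      case 10
      show False
        by (rule C5[of p r q s v0]) (use 10 facts in \<open>simp_all add: Z parcs_sym path_abcd_def\<close>)
    next
      case 11
      show False
        by (rule cogem[of r v0 p s q]) (use 11 facts in \<open>simp_all add: Z parcs_sym path_abcd_def\<close>)
    next
      case 12
      show False
        by (rule bull[of p v0 s q r]) (use 12 facts in \<open>simp_all add: Z parcs_sym path_abcd_def\<close>)
    next
      case 13
      show False
        by (rule gem[of r s q v0 p]) (use 13 facts in \<open>simp_all add: Z parcs_sym path_abcd_def\<close>)
    next
      case 14
      show False
        by (rule bull[of r p v0 s q]) (use 14 facts in \<open>simp_all add: Z parcs_sym path_abcd_def\<close>)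
    next
      case 15
      show False
        by (rule gem[of r v0 p s q]) (use 15 facts in \<open>simp_all add: Z parcs_sym path_abcd_def\<close>)
    next
      case 16
      show False
        by (rule gem[of p q r s v0]) (use 16 facts in \<open>simp_all add: Z parcs_sym path_abcd_def\<close>)
    qed
  qed
  moreover have "symp R"
    by (auto simp: symp_def R_def parcs_sym)
  ultimately have "switched_cograph G Z R"
    by unfold_locales (auto simp: R_def)
  then show thesis by (rule that)
qed


section \<open>The runner's invariant and the finite check on five vertices\<close>

section \<open>The runner wins on the excluded graphs\<close>

text \<open>An invariant \<open>safe\<close> that the runner can restore after every announcement
  defeats each strategy. The play is built by recursion along the history.\<close>

lemma runner_wins:
  assumes "1 \<le> k" and start: "safe G v0" "v0 \<in> pverts G"
    and safe: "\<And>H v. safe H v \<Longrightarrow> \<not> isolated H v"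
    and step: "\<And>H H' v. \<lbrakk>k_flip k G H; k_flip k G H'; safe H v\<rbrakk> \<Longrightarrow>
      \<exists>w. safe H' w \<and> reach_within r H v w"
  shows "\<not> winning_strategy r k G \<sigma>"
proof
  assume win: "winning_strategy r k G \<sigma>"
  define ann where "ann h = (if h = [] then G else \<sigma> h)" for h
  \<comment> \<open>The runner already sees the new graph \<open>ann h\<close> but moves in the
    previous one, \<open>ann (butlast h)\<close>.\<close>
  define pick where "pick h = (if h = [] then v0
    else SOME w. safe (ann h) w \<and> reach_within r (ann (butlast h)) (last h) w)" for h
  define hist where "hist = rec_nat [] (\<lambda>_ h. h @ [pick h])"
  define v where "v n = pick (hist n)" for n
  have hist_Suc: "hist (Suc n) = hist n @ [v n]" for n
    by (simp add: hist_def v_def)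
  have hist: "hist n = map v [0..<n]" for n
    by (induction n) (simp_all add: hist_Suc, simp add: hist_def)
  have announced: "announced G \<sigma> v n = ann (hist n)" for n
    by (simp add: announced_def ann_def hist)
  have flip: "k_flip k G (ann h)" for h
    using win k_flip_refl[OF assms(1)] by (auto simp: ann_def winning_strategy_def)
  have pick: "safe (ann (hist (Suc n))) (v (Suc n)) \<and> reach_within r (ann (hist n)) (v n) (v (Suc n))"
    if "safe (ann (hist n)) (v n)" for n
  proof -
    have "v (Suc n) = (SOME w. safe (ann (hist (Suc n))) w \<and> reach_within r (ann (hist n)) (v n) w)"
      unfolding v_def[of "Suc n"] pick_def by (simp add: hist_Suc)
    then show ?thesis
      using someI_ex[OF step[OF flip flip that]] by simp
  qed
  have safe_play: "safe (ann (hist n)) (v n)" for n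
  proof (induction n)
    case 0
    then show ?case
      using start(1) by (simp add: v_def hist pick_def ann_def)
  qed (use pick in blast)
  have "v 0 = v0"
    by (simp add: v_def hist pick_def)
  then have "runner_play r G \<sigma> v"
    using pick[OF safe_play] start(2) by (simp add: runner_play_def announced)
  then obtain n where "isolated (announced G \<sigma> v n) (v n)"
    using win unfolding winning_strategy_def by blast
  then show False
    using safe[OF safe_play] unfolding announced by blast
qed

text \<open>A 2-flip seen on the five vertices: \<open>c\<close> colours the two parts, and
  \<open>f\<close> says which colour pairs are flipped.\<close>

definition flip_arc :: "nat rel \<Rightarrow> (nat \<Rightarrow> bool) \<Rightarrow> (bool \<Rightarrow> bool \<Rightarrow> bool) \<Rightarrow> nat \<Rightarrow> nat \<Rightarrow> bool" where
  "flip_arc E c f x y \<longleftrightarrow> x \<noteq> y \<and> (((x, y) \<in> E \<union> E\<inverse>) \<noteq> f (c x) (c y))"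

text \<open>The first half keeps one of two candidates other than 4 safe; the second half supplies
  two candidates when the current edge uses 4.\<close>

definition robust :: "nat rel \<Rightarrow> bool" where
  "robust E \<longleftrightarrow> (\<forall>c f. f False True = f True False \<longrightarrow>
     (\<forall>x\<in>{0,1,2,3,4}. \<forall>y\<in>{0,1,2,3,4}. x \<noteq> y \<longrightarrow> x \<noteq> 4 \<longrightarrow> y \<noteq> 4 \<longrightarrow>
       (\<exists>z\<in>{0,1,2,3,4}. flip_arc E c f x z \<or> flip_arc E c f y z)) \<and>
     (\<forall>u\<in>{0,1,2,3,4}. flip_arc E c f 4 u \<longrightarrow>
       (\<exists>w\<in>{0,1,2,3,4}. w \<noteq> 4 \<and> w \<noteq> u \<and> (flip_arc E c f 4 w \<or> flip_arc E c f u w))))"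

text \<open>The runner stays in the embedded copy of the excluded graph, never at a vertex isolated
  there. Two vertices other than 4 are always within two steps, and no 2-flip isolates both inside
  the copy.\<close>

lemma runner_wins_if_robust:
  assumes "pair_graph G" "pair_graph (five_vertex_graph E)" "2 \<le> r" "robust E"
    and "contains_induced G (five_vertex_graph E)"
  shows "\<not> winning_strategy r 2 G \<sigma>"
proof -
  interpret pair_graph G by fact
  interpret F: pair_graph "five_vertex_graph E" by fact
  let ?V = "{0, 1, 2, 3, 4} :: nat set"
  have F: "pverts (five_vertex_graph E) = ?V" "parcs (five_vertex_graph E) = E \<union> E\<inverse>"
    by (simp_all add: five_vertex_graph_def)
  obtain g where g: "inj_on g ?V" "g ` ?V \<subseteq> pverts G"
    and g_arc: "\<forall>x\<in>?V. \<forall>y\<in>?V. (g x, g y) \<in> parcs G \<longleftrightarrow> (x, y) \<in> E \<union> E\<inverse>"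
    using assms(5) unfolding contains_induced_iff[OF pair_wf_digraph F.pair_wf_digraph] F
    by (elim exE conjE)
  define V where "V = ?V"
  have flip: "\<exists>c f. f False True = f True False \<and>
      (\<forall>x\<in>V. \<forall>y\<in>V. (g x, g y) \<in> parcs H \<longleftrightarrow> flip_arc E c f x y)" if "k_flip 2 G H" for H
  proof -
    from k_flip_two_coloring[OF assms(1) that]
    obtain c :: "'a \<Rightarrow> bool" and f where f: "\<forall>p q. f p q = f q p" and H: "\<forall>u\<in>pverts G. \<forall>v\<in>pverts G.
        (u, v) \<in> parcs H \<longleftrightarrow> u \<noteq> v \<and> (((u, v) \<in> parcs G) \<noteq> f (c u) (c v))"
      by (elim exE conjE)
    have "(g x, g y) \<in> parcs H \<longleftrightarrow> flip_arc E (c \<circ> g) f x y" if "x \<in> V" "y \<in> V" for x y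
    proof -
      have "g x \<in> pverts G" "g y \<in> pverts G" "g x = g y \<longleftrightarrow> x = y"
        "(g x, g y) \<in> parcs G \<longleftrightarrow> (x, y) \<in> E \<union> E\<inverse>"
        using that g g_arc unfolding V_def[symmetric] by (blast dest: inj_onD)+
      then show ?thesis
        using H unfolding flip_arc_def comp_def by metis
    qed
    then show ?thesis
      using f by (intro exI[of _ "c \<circ> g"] exI[of _ f]) blast
  qed
  have robust: "\<exists>z\<in>V. flip_arc E c f x z \<or> flip_arc E c f y z"
    if "f False True = f True False" "x \<in> V" "y \<in> V" "x \<noteq> y" "x \<noteq> 4" "y \<noteq> 4" for c f x y
    using that assms(4)[unfolded robust_def V_def[symmetric]] by blast
  have robust4: "\<exists>w\<in>V. w \<noteq> 4 \<and> w \<noteq> u \<and> (flip_arc E c f 4 w \<or> flip_arc E c f u w)"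
    if "f False True = f True False" "u \<in> V" "flip_arc E c f 4 u" for c f u
    using that assms(4)[unfolded robust_def V_def[symmetric]] by blast
  \<comment> \<open>The neighbour must lie in the copy, so that safety is decided by
    \<open>flip_arc\<close> on five vertices alone.\<close>
  define safe where
    "safe H v \<longleftrightarrow> (\<exists>x\<in>V. v = g x \<and> (\<exists>y\<in>V. (g x, g y) \<in> parcs H))" for H :: "'a pair_pre_digraph" and v
  have "k_flip 2 G G"
    by (rule k_flip_refl) simp
  from flip[OF this] obtain c f where cf: "f False True = f True False"
    "\<forall>x\<in>V. \<forall>y\<in>V. (g x, g y) \<in> parcs G \<longleftrightarrow> flip_arc E c f x y"
    by (elim exE conjE)
  have "0 \<in> V" "1 \<in> V"
    by (auto simp: V_def)
  then obtain v0 where v0: "safe G v0"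
    using robust[OF cf(1), of 0 1 c] cf(2) unfolding safe_def by force
  show ?thesis
  proof (rule runner_wins)
    show "safe G v0" by fact
    show "v0 \<in> pverts G"
      using v0 g(2) unfolding safe_def V_def by blast
    fix H v assume "safe H v"
    then show "\<not> isolated H v"
      unfolding safe_def isolated_def by blast
  next
    fix H H' v assume H: "k_flip 2 G H" and H': "k_flip 2 G H'" and "safe H v"
    then obtain x y where xy: "x \<in> V" "y \<in> V" "v = g x" "(g x, g y) \<in> parcs H"
      unfolding safe_def by blast
    from flip[OF H] obtain c f where cf: "f False True = f True False"
      "\<forall>x\<in>V. \<forall>y\<in>V. (g x, g y) \<in> parcs H \<longleftrightarrow> flip_arc E c f x y"
      by (elim exE conjE)
    from flip[OF H'] obtain c' f' where cf': "f' False True = f' True False"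
      "\<forall>x\<in>V. \<forall>y\<in>V. (g x, g y) \<in> parcs H' \<longleftrightarrow> flip_arc E c' f' x y"
      by (elim exE conjE)
    have arc_sym: "flip_arc E c f b a" if "flip_arc E c f a b" for a b
      using that cf(1) by (cases "c a"; cases "c b") (auto simp: flip_arc_def)
    have arc_xy: "flip_arc E c f x y" "x \<noteq> y"
      using xy cf(2) by (auto simp: flip_arc_def)
    define near where
      "near z \<longleftrightarrow> x = z \<or> flip_arc E c f x z \<or> (\<exists>t\<in>V. flip_arc E c f x t \<and> flip_arc E c f t z)" for z
    \<comment> \<open>If the edge \<open>x y\<close> avoids 4, its ends serve. Otherwise take its
      end other than 4 and the third vertex from \<open>robust4\<close>, at distance at most two
      from \<open>x\<close>.\<close>
    obtain p q where pq: "p \<in> V" "q \<in> V" "p \<noteq> q" "p \<noteq> 4" "q \<noteq> 4" "near p" "near q"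
    proof -
      consider "x \<noteq> 4" "y \<noteq> 4" | "x = 4" "y \<noteq> 4" | "x \<noteq> 4" "y = 4"
        using arc_xy(2) by blast
      then show thesis
      proof cases
        case 1
        then show thesis using that[of x y] xy arc_xy unfolding near_def by blast
      next
        case 2
        then obtain w where "w \<in> V" "w \<noteq> 4" "w \<noteq> y" "flip_arc E c f x w \<or> flip_arc E c f y w"
          using robust4[OF cf(1), of y c] xy(2) arc_xy(1) by blast
        then show thesis using 2 that[of y w] xy(2) arc_xy unfolding near_def by blast
      next
        case 3
        then obtain w where "w \<in> V" "w \<noteq> 4" "w \<noteq> x" "flip_arc E c f y w \<or> flip_arc E c f x w"
          using robust4[OF cf(1), of x c] xy(1) arc_sym[OF arc_xy(1)] by blast
        then show thesis using 3 that[of x w] xy(1,2) arc_xy unfolding near_def by blast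
      qed
    qed
    then obtain z where z: "z \<in> V" "near z" "safe H' (g z)"
      using robust[OF cf'(1) pq(1-5), of c'] cf'(2) unfolding safe_def by blast
    have "reach_within r H v (g z)"
    proof (rule reach_within_2)
      have "g ` V \<subseteq> pverts H"
        using g(2) unfolding V_def k_flipD_pverts[OF H] .
      then show "v \<in> pverts H"
        using xy by blast
      show "v = g z \<or> (v, g z) \<in> parcs H \<or> (\<exists>w. (v, w) \<in> parcs H \<and> (w, g z) \<in> parcs H)"
        using z(2) cf(2) z(1) xy(1) unfolding near_def xy(3) by blast
      show "a \<noteq> b \<and> b \<in> pverts H" if "(a, b) \<in> parcs H" for a b
        using k_flip_arcD[OF pair_loopfree_digraph_axioms H that] k_flipD_pverts[OF H] by simp
    qed fact
    with z(3) show "\<exists>w. safe H' w \<and> reach_within r H v w" by blast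
  qed simp
qed

text \<open>For each graph there are only 32 colourings and 8 symmetric choices of \<open>f\<close>,
  so a case check suffices.\<close>

lemma robust_excluded:
  "robust {(0, 1), (1, 2), (2, 3), (3, 4), (4, 0)}"
  "robust (path_abcd \<union> {(4, 1), (4, 2)})"
  "robust (path_abcd \<union> {(4, 0), (4, 1), (4, 2), (4, 3)})"
  "robust path_abcd"
  unfolding robust_def path_abcd_def flip_arc_def
  by (intro allI impI; simp; case_tac "c 0"; case_tac "c (Suc 0)"; case_tac "c 2";
      case_tac "c 3"; case_tac "c 4"; simp;
      case_tac "f True True"; case_tac "f True False"; case_tac "f False False"; simp)+

section \<open>The characterization\<close>

theorem theorem1p1:
  fixes G :: "'a pair_pre_digraph" and r :: enat
  assumes "pair_graph G"
    and "r \<ge> 2"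
  shows "flip_width r G \<le> 2 \<longleftrightarrow>
    \<not> contains_induced G C5_graph \<and>
    \<not> contains_induced G bull_graph \<and>
    \<not> contains_induced G gem_graph \<and>
    \<not> contains_induced G cogem_graph"
proof -
  have "(\<exists>\<sigma>. winning_strategy r 2 G \<sigma>) \<longleftrightarrow>
    \<not> contains_induced G C5_graph \<and>
    \<not> contains_induced G bull_graph \<and>
    \<not> contains_induced G gem_graph \<and>
    \<not> contains_induced G cogem_graph" (is "_ \<longleftrightarrow> ?free")
  proof
    assume "\<exists>\<sigma>. winning_strategy r 2 G \<sigma>"
    then show ?free
      using runner_wins_if_robust[OF assms(1) _ assms(2)] robust_excluded
        pair_graph_C5 pair_graph_bull pair_graph_gem pair_graph_cogem
      unfolding C5_graph_def bull_graph_def gem_graph_def cogem_graph_def by blast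
  next
    assume free: ?free
    show "\<exists>\<sigma>. winning_strategy r 2 G \<sigma>"
    proof (cases "pverts G = {}")
      case True
      \<comment> \<open>Without vertices the runner cannot start, so the strategy wins vacuously;
        there is also no \<open>v0\<close> to isolate.\<close>
      then have "winning_strategy r 2 G (\<lambda>_. G)"
        by (simp add: winning_strategy_def runner_play_def k_flip_refl)
      then show ?thesis by blast
    next
      case False
      then obtain v0 where "v0 \<in> pverts G" by blast
      then obtain Z R where "switched_cograph G Z R"
        using switched_cograph_if_free[OF assms(1)] free by blast
      then show ?thesis
        using switched_cograph.flipper_wins by blast
    qed
  qed
  then show ?thesis
    using flip_width_le_iff[OF assms(1), of 2 r] by simp
qed

end
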